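(* Let $A$ be a commutative dual ring. Then the map $\operatorname{Ann}\colon \operatorname{CoSp}(A)\to \operatorname{Spec}(A)$, $C\mapsto \operatorname{Ann}(C)$, is a homeomorphism, where $\operatorname{Spec}(A)$ carries the Zariski topology.
   Context: All rings are commutative with identity. For ideals $I,J$ of a ring $A$, $\operatorname{Ann}(I)=\{a\in A\mid aI=0\}$ and $(J:I)=\{a\in A\mid aI\subseteq J\}$. A ring $A$ is a dual ring if $\operatorname{Ann}(\operatorname{Ann}(I))=I$ for every ideal $I$ of $A$. The coproduct of $I$ and $J$ is the ideal $[I:J]:=(J:\operatorname{Ann}(I))=\{a\in A\mid a\operatorname{Ann}(I)\subseteq J\}$. An ideal $C$ of $A$ is coprime if $C\neq 0$ and, for all ideals $I,J$ of $A$, $C\subseteq [I:J]$ implies $C\subseteq I$ or $C\subseteq J$. $\operatorname{CoSp}(A)$ is the set of coprime ideals of $A$, regarded as a topological space whose closed sets are exactly the sets $V_c(I)=\{C\in\operatorname{CoSp}(A)\mid C\subseteq I\}$ for $I$ an ideal of $A$. *)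

theory Defs
  imports "HOL-Algebra.Ideal" "HOL-Analysis.Abstract_Topology"
begin

section \<open>Annihilators, quotients and coproducts of ideals\<close>

definition annihilator :: "('a, 'b) ring_scheme \<Rightarrow> 'a set \<Rightarrow> 'a set" where
  "annihilator R I = {a \<in> carrier R. \<forall>x\<in>I. a \<otimes>\<^bsub>R\<^esub> x = \<zero>\<^bsub>R\<^esub>}"

text \<open>The term \<open>ideal_quotient R J I\<close> stands for \<open>(J : I)\<close>, and
  \<open>ideal_coproduct R I J\<close> for \<open>[I : J]\<close>; note the order of the arguments.\<close>

definition ideal_quotient :: "('a, 'b) ring_scheme \<Rightarrow> 'a set \<Rightarrow> 'a set \<Rightarrow> 'a set" where
  "ideal_quotient R J I = {a \<in> carrier R. \<forall>x\<in>I. a \<otimes>\<^bsub>R\<^esub> x \<in> J}"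

definition ideal_coproduct :: "('a, 'b) ring_scheme \<Rightarrow> 'a set \<Rightarrow> 'a set \<Rightarrow> 'a set" where
  "ideal_coproduct R I J = ideal_quotient R J (annihilator R I)"

locale dual_ring = cring +
  assumes annihilator_annihilator: "ideal I R \<Longrightarrow> annihilator R (annihilator R I) = I"

locale coprimeideal = ideal + cring +
  assumes I_nonzero: "I \<noteq> {\<zero>}"
    and I_coprime: "\<lbrakk>ideal J R; ideal K R; I \<subseteq> ideal_coproduct R J K\<rbrakk> \<Longrightarrow> I \<subseteq> J \<or> I \<subseteq> K"


section \<open>The prime spectrum with the Zariski topology\<close>

definition Spec :: "('a, 'b) ring_scheme \<Rightarrow> 'a set set" where
  "Spec R = {P. primeideal P R}"

definition zero_locus :: "('a, 'b) ring_scheme \<Rightarrow> 'a set \<Rightarrow> 'a set set" where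
  "zero_locus R I = {P \<in> Spec R. I \<subseteq> P}"

definition zariski_topology :: "('a, 'b) ring_scheme \<Rightarrow> 'a set topology" where
  "zariski_topology R = topology (\<lambda>U. \<exists>I. ideal I R \<and> U = Spec R - zero_locus R I)"


section \<open>The coprime spectrum\<close>

definition CoSp :: "('a, 'b) ring_scheme \<Rightarrow> 'a set set" where
  "CoSp R = {C. coprimeideal C R}"

definition Vc :: "('a, 'b) ring_scheme \<Rightarrow> 'a set \<Rightarrow> 'a set set" where
  "Vc R I = {C \<in> CoSp R. C \<subseteq> I}"

definition cosp_topology :: "('a, 'b) ring_scheme \<Rightarrow> 'a set topology" where
  "cosp_topology R = topology (\<lambda>U. \<exists>I. ideal I R \<and> U = CoSp R - Vc R I)"


section \<open>The closed sets of the two topologies\<close>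

text \<open>The function \<open>topology\<close> is only meaningful for predicates satisfying
  \<open>istopology\<close>. Both predicates above do so over any commutative ring, and the closed sets are
  exactly the sets \<open>zero_locus R I\<close> and \<open>Vc R I\<close>, respectively.\<close>

lemma topology_closed_family:
  assumes sub: "\<And>i. i \<in> A \<Longrightarrow> F i \<subseteq> X"
    and top: "\<exists>i\<in>A. F i = X"
    and empty: "\<exists>i\<in>A. F i = {}"
    and un: "\<And>i j. \<lbrakk>i \<in> A; j \<in> A\<rbrakk> \<Longrightarrow> \<exists>k\<in>A. F k = F i \<union> F j"
    and inter: "\<And>B. \<lbrakk>B \<subseteq> A; B \<noteq> {}\<rbrakk> \<Longrightarrow> \<exists>k\<in>A. F k = (\<Inter>i\<in>B. F i)"
  shows "closedin (topology (\<lambda>U. \<exists>i. i \<in> A \<and> U = X - F i)) S \<longleftrightarrow> (\<exists>i\<in>A. S = F i)"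
    and "topspace (topology (\<lambda>U. \<exists>i. i \<in> A \<and> U = X - F i)) = X"
proof -
  let ?T = "\<lambda>U. \<exists>i. i \<in> A \<and> U = X - F i"
  have *: "istopology ?T"
    unfolding istopology_def
  proof (intro conjI allI impI)
    fix S T assume "?T S" "?T T"
    then obtain i j where ij: "i \<in> A" "S = X - F i" "j \<in> A" "T = X - F j" by blast
    obtain k where "k \<in> A" "F k = F i \<union> F j" using un ij by blast
    then show "?T (S \<inter> T)" using ij by blast
  next
    fix K assume K: "\<forall>S\<in>K. ?T S"
    show "?T (\<Union>K)"
    proof (cases "K = {}")
      case True
      then show ?thesis using top by auto
    next
      case False
      obtain f where f: "\<And>S. S \<in> K \<Longrightarrow> f S \<in> A \<and> S = X - F (f S)"
        using K by metis
      obtain k where k: "k \<in> A" "F k = (\<Inter>i\<in>f ` K. F i)"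
        using inter[of "f ` K"] f False by blast
      have "\<Union>K = X - F k" unfolding k(2) using f by fastforce
      then show ?thesis using k(1) by blast
    qed
  qed
  have op: "openin (topology ?T) U \<longleftrightarrow> ?T U" for U
    using topology_inverse'[OF *] by simp
  obtain e where e: "e \<in> A" "F e = {}" using empty by blast
  then have "openin (topology ?T) X" unfolding op by (intro exI[of _ e]) simp
  moreover have "U \<subseteq> X" if "openin (topology ?T) U" for U using that unfolding op by blast
  ultimately show sp: "topspace (topology ?T) = X"
    unfolding topspace_def by blast
  show "closedin (topology ?T) S \<longleftrightarrow> (\<exists>i\<in>A. S = F i)"
    unfolding closedin_def sp op
  proof (intro iffI conjI; (elim conjE exE bexE)?)
    fix i assume i: "S \<subseteq> X" "i \<in> A" "X - S = X - F i"
    then have "S = F i" using sub[OF i(2)] by blast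
    then show "\<exists>i\<in>A. S = F i" using i(2) by blast
  next
    fix i assume "i \<in> A" "S = F i"
    then show "S \<subseteq> X" "\<exists>i. i \<in> A \<and> X - S = X - F i" using sub by auto
  qed
qed

context cring
begin

lemma ideal_ideal_coproduct:
  assumes "ideal I R" "ideal J R"
  shows "ideal (ideal_coproduct R I J) R"
proof -
  interpret J: ideal J R by fact
  have ann: "x \<in> carrier R" if "x \<in> annihilator R I" for x
    using that by (simp add: annihilator_def)
  have mem: "a \<in> ideal_coproduct R I J \<longleftrightarrow>
      a \<in> carrier R \<and> (\<forall>x\<in>annihilator R I. a \<otimes> x \<in> J)" for a
    by (simp add: ideal_coproduct_def ideal_quotient_def)
  have mult: "b \<otimes> a \<in> ideal_coproduct R I J"
    if "a \<in> ideal_coproduct R I J" "b \<in> carrier R" for a b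
    using that by (simp add: mem ann m_assoc J.I_l_closed)
  have uminus: "\<ominus> a \<in> ideal_coproduct R I J" if "a \<in> ideal_coproduct R I J" for a
    using that by (simp add: mem ann l_minus J.a_inv_closed)
  show ?thesis
  proof (rule idealI[OF ring_axioms])
    show "subgroup (ideal_coproduct R I J) (add_monoid R)"
    proof (rule add.subgroupI)
      show "ideal_coproduct R I J \<subseteq> carrier R" by (auto simp: mem)
      have "\<zero> \<in> ideal_coproduct R I J" by (simp add: mem ann)
      then show "ideal_coproduct R I J \<noteq> {}" by blast
    next
      fix a assume "a \<in> ideal_coproduct R I J"
      then show "\<ominus> a \<in> ideal_coproduct R I J" by (rule uminus)
    next
      fix a b assume "a \<in> ideal_coproduct R I J" "b \<in> ideal_coproduct R I J"
      then show "a \<oplus> b \<in> ideal_coproduct R I J"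
        by (simp add: mem ann l_distr J.a_closed)
    qed
  next
    fix a x assume *: "a \<in> ideal_coproduct R I J" "x \<in> carrier R"
    then show "x \<otimes> a \<in> ideal_coproduct R I J" by (rule mult)
    with * show "a \<otimes> x \<in> ideal_coproduct R I J" by (simp add: mem m_comm)
  qed
qed

lemma le_ideal_coproduct:
  assumes "ideal I R" "ideal J R"
  shows "I \<subseteq> ideal_coproduct R I J" "J \<subseteq> ideal_coproduct R I J"
proof -
  interpret I: ideal I R by fact
  interpret J: ideal J R by fact
  show "I \<subseteq> ideal_coproduct R I J"
    by (auto simp: ideal_coproduct_def ideal_quotient_def annihilator_def m_comm)
  show "J \<subseteq> ideal_coproduct R I J"
    by (auto simp: ideal_coproduct_def ideal_quotient_def annihilator_def J.I_r_closed)
qed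

lemma cosp_closed_family:
  "closedin (cosp_topology R) S \<longleftrightarrow> (\<exists>I\<in>{I. ideal I R}. S = Vc R I)"
  "topspace (cosp_topology R) = CoSp R"
proof -
  have 1: "Vc R I \<subseteq> CoSp R" for I by (auto simp: Vc_def)
  have "Vc R (carrier R) = CoSp R"
    by (auto simp: Vc_def CoSp_def coprimeideal_def dest: ideal.Icarr)
  then have 2: "\<exists>I\<in>{I. ideal I R}. Vc R I = CoSp R" using oneideal by blast
  have "Vc R {\<zero>} = {}"
    by (auto simp: Vc_def CoSp_def coprimeideal_def coprimeideal_axioms_def
        dest: additive_subgroup.zero_closed[OF ideal.axioms(1)])
  then have 3: "\<exists>I\<in>{I. ideal I R}. Vc R I = {}" using zeroideal by blast
  have 4: "\<exists>K\<in>{I. ideal I R}. Vc R K = Vc R I \<union> Vc R J"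
    if "I \<in> {I. ideal I R}" "J \<in> {I. ideal I R}" for I J
  proof -
    have IJ: "ideal I R" "ideal J R" using that by auto
    have "Vc R (ideal_coproduct R I J) = Vc R I \<union> Vc R J"
      using le_ideal_coproduct[OF IJ] coprimeideal.I_coprime[OF _ IJ]
      by (fastforce simp: Vc_def CoSp_def)
    then show ?thesis using ideal_ideal_coproduct[OF IJ] by blast
  qed
  have 5: "\<exists>K\<in>{I. ideal I R}. Vc R K = (\<Inter>I\<in>B. Vc R I)"
    if "B \<subseteq> {I. ideal I R}" "B \<noteq> {}" for B
  proof -
    have "ideal (\<Inter>B) R" using i_Intersect that by blast
    moreover have "Vc R (\<Inter>B) = (\<Inter>I\<in>B. Vc R I)" using that(2) by (auto simp: Vc_def)
    ultimately show ?thesis by blast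
  qed
  note * = topology_closed_family[of "{I. ideal I R}" "Vc R", OF 1 2 3 4 5]
  show "closedin (cosp_topology R) S \<longleftrightarrow> (\<exists>I\<in>{I. ideal I R}. S = Vc R I)"
    using *(1) by (simp add: cosp_topology_def)
  show "topspace (cosp_topology R) = CoSp R"
    using *(2) by (simp add: cosp_topology_def)
qed

lemma closedin_cosp_topology:
  "closedin (cosp_topology R) S \<longleftrightarrow> (\<exists>I. ideal I R \<and> S = Vc R I)"
  using cosp_closed_family(1) by simp

lemma topspace_cosp_topology: "topspace (cosp_topology R) = CoSp R"
  by (rule cosp_closed_family(2))

lemma zariski_closed_family:
  "closedin (zariski_topology R) S \<longleftrightarrow> (\<exists>I\<in>{I. ideal I R}. S = zero_locus R I)"
  "topspace (zariski_topology R) = Spec R"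
proof -
  have 1: "zero_locus R I \<subseteq> Spec R" for I by (auto simp: zero_locus_def)
  have "zero_locus R {\<zero>} = Spec R"
    by (auto simp: zero_locus_def Spec_def primeideal_def
        intro: additive_subgroup.zero_closed[OF ideal.axioms(1)])
  then have 2: "\<exists>I\<in>{I. ideal I R}. zero_locus R I = Spec R" using zeroideal by blast
  have "zero_locus R (carrier R) = {}"
    by (auto simp: zero_locus_def Spec_def dest: ideal.Icarr[OF primeideal.axioms(1)]
        primeideal.I_notcarr)
  then have 3: "\<exists>I\<in>{I. ideal I R}. zero_locus R I = {}" using oneideal by blast
  have 4: "\<exists>K\<in>{I. ideal I R}. zero_locus R K = zero_locus R I \<union> zero_locus R J"
    if "I \<in> {I. ideal I R}" "J \<in> {I. ideal I R}" for I J
  proof -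
    have IJ: "ideal I R" "ideal J R" using that by auto
    have "I \<subseteq> P \<or> J \<subseteq> P" if P: "primeideal P R" "I \<inter> J \<subseteq> P" for P
    proof (rule ccontr)
      assume "\<not> (I \<subseteq> P \<or> J \<subseteq> P)"
      then obtain a b where ab: "a \<in> I" "a \<notin> P" "b \<in> J" "b \<notin> P" by blast
      have c: "a \<in> carrier R" "b \<in> carrier R" using ab IJ by (auto dest: ideal.Icarr)
      have "a \<otimes> b \<in> I \<inter> J"
        using ab c IJ by (auto intro: ideal.I_r_closed ideal.I_l_closed)
      then show False using primeideal.I_prime[OF P(1) c] P(2) ab by blast
    qed
    then have "zero_locus R (I \<inter> J) = zero_locus R I \<union> zero_locus R J" by (auto simp: zero_locus_def Spec_def)
    then show ?thesis using i_intersect[OF IJ] by blast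
  qed
  have 5: "\<exists>K\<in>{I. ideal I R}. zero_locus R K = (\<Inter>I\<in>B. zero_locus R I)"
    if "B \<subseteq> {I. ideal I R}" "B \<noteq> {}" for B
  proof -
    have car: "\<Union>B \<subseteq> carrier R" using that(1) by (auto dest: ideal.Icarr)
    have "Idl (\<Union>B) \<subseteq> P \<longleftrightarrow> \<Union>B \<subseteq> P" if "primeideal P R" for P
      using genideal_self[OF car] genideal_minimal[of P] primeideal.axioms(1)[OF that]
      by blast
    then have "zero_locus R (Idl (\<Union>B)) = (\<Inter>I\<in>B. zero_locus R I)"
      using that(2) by (auto simp: zero_locus_def Spec_def)
    then show ?thesis using genideal_ideal[OF car] by blast
  qed
  note * = topology_closed_family[of "{I. ideal I R}" "zero_locus R", OF 1 2 3 4 5]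
  show "closedin (zariski_topology R) S \<longleftrightarrow> (\<exists>I\<in>{I. ideal I R}. S = zero_locus R I)"
    using *(1) by (simp add: zariski_topology_def)
  show "topspace (zariski_topology R) = Spec R"
    using *(2) by (simp add: zariski_topology_def)
qed

lemma closedin_zariski_topology:
  "closedin (zariski_topology R) S \<longleftrightarrow> (\<exists>I. ideal I R \<and> S = zero_locus R I)"
  using zariski_closed_family(1) by simp

lemma topspace_zariski_topology: "topspace (zariski_topology R) = Spec R"
  by (rule zariski_closed_family(2))

end

end

(* In a dual ring, Ann is an inclusion-reversing involution on the ideals, so only the
   correspondence between coprime and prime ideals needs an argument. If C is coprime and
   a * b is in Ann(C), then C is contained in [Ann(a) : Ann(b)], because Ann(Ann(a)) is the
   principal ideal (a). If P is prime and Ann(P) is contained in [I : J], then Ann(I) * Ann(J)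
   annihilates Ann(P) and hence lies in Ann(Ann(P)) = P. *)

theory Submission
  imports Defs
begin

context cring
begin

text \<open>By commutativity, both inclusions say that every product of an element of
  \<open>I\<close> with an element of \<open>J\<close> vanishes.\<close>

lemma subset_annihilator_commute:
  assumes "I \<subseteq> carrier R" "J \<subseteq> carrier R"
  shows "I \<subseteq> annihilator R J \<longleftrightarrow> J \<subseteq> annihilator R I"
proof -
  have "x \<otimes> y = y \<otimes> x" if "x \<in> I" "y \<in> J" for x y
    using that assms by (auto intro: m_comm)
  then show ?thesis
    using assms by (fastforce simp: annihilator_def)
qed

lemma ideal_annihilator:
  assumes "S \<subseteq> carrier R"
  shows "ideal (annihilator R S) R"
proof (rule idealI[OF ring_axioms])
  have S: "x \<in> carrier R" if "x \<in> S" for x using that assms by blast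
  show "subgroup (annihilator R S) (add_monoid R)"
  proof (rule add.subgroupI)
    show "annihilator R S \<subseteq> carrier R" by (auto simp: annihilator_def)
    have "\<zero> \<in> annihilator R S" by (simp add: annihilator_def S)
    then show "annihilator R S \<noteq> {}" by blast
  next
    fix a assume "a \<in> annihilator R S"
    then show "\<ominus> a \<in> annihilator R S" by (simp add: annihilator_def S l_minus)
  next
    fix a b assume "a \<in> annihilator R S" "b \<in> annihilator R S"
    then show "a \<oplus> b \<in> annihilator R S" by (simp add: annihilator_def S l_distr)
  qed
next
  fix a x assume *: "a \<in> annihilator R S" "x \<in> carrier R"
  then show "x \<otimes> a \<in> annihilator R S"
    using assms by (auto simp: annihilator_def m_assoc subset_iff)
  with * show "a \<otimes> x \<in> annihilator R S" by (simp add: annihilator_def m_comm)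
qed

lemma annihilator_carrier: "annihilator R (carrier R) = {\<zero>}"
proof -
  have "a = \<zero>" if "a \<in> carrier R" "\<forall>x\<in>carrier R. a \<otimes> x = \<zero>" for a
    using that r_one[of a] one_closed by metis
  then show ?thesis by (auto simp: annihilator_def)
qed

lemma annihilator_zero: "annihilator R {\<zero>} = carrier R"
  by (auto simp: annihilator_def)

text \<open>Duality speaks of ideals only; this equality lets it apply to a single element, so that
  the double annihilator of \<open>{a}\<close> becomes \<open>PIdl a\<close>.\<close>

lemma annihilator_cgenideal:
  assumes "a \<in> carrier R"
  shows "annihilator R (PIdl a) = annihilator R {a}"
proof -
  have "x \<otimes> (r \<otimes> a) = \<zero>" if "x \<in> carrier R" "r \<in> carrier R" "x \<otimes> a = \<zero>" for x r
    using that assms by (simp add: m_lcomm)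
  then show ?thesis
    using cgenideal_self[OF assms] by (fastforce simp: annihilator_def cgenideal_def)
qed

end

context dual_ring
begin

lemma primeideal_annihilator:
  assumes "coprimeideal C R"
  shows "primeideal (annihilator R C) R"
proof -
  interpret C: coprimeideal C R by fact
  have idC: "ideal C R" by (rule C.ideal_axioms)
  show ?thesis
  proof (rule primeidealI)
    show "ideal (annihilator R C) R" by (rule ideal_annihilator[OF C.a_subset])
    show "cring R" by (rule cring_axioms)
    \<comment> \<open>If Ann(C) were the whole ring, duality would give C = Ann(A) = 0.\<close>
    show "carrier R \<noteq> annihilator R C"
      using annihilator_annihilator[OF idC] annihilator_carrier C.I_nonzero by metis
  next
    fix a b assume a: "a \<in> carrier R" and b: "b \<in> carrier R" and ab: "a \<otimes> b \<in> annihilator R C"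
    have ids: "ideal (annihilator R {a}) R" "ideal (annihilator R {b}) R"
      using a b by (simp_all add: ideal_annihilator)
    have Ann_a: "annihilator R (annihilator R {a}) = PIdl a"
      using annihilator_annihilator[OF cgenideal_ideal[OF a]] annihilator_cgenideal[OF a] by simp
    \<comment> \<open>By \<open>Ann_a\<close>, the elements of Ann(Ann(a)) are the multiples
      \<open>r \<otimes> a\<close>, so this says that \<open>c\<close> carries Ann(Ann(a)) into
      Ann(b).\<close>
    have "c \<otimes> (r \<otimes> a) \<otimes> b = \<zero>" if c: "c \<in> C" and r: "r \<in> carrier R" for c r
    proof -
      have c': "c \<in> carrier R" using c by (rule C.Icarr)
      have "c \<otimes> (r \<otimes> a) \<otimes> b = r \<otimes> ((a \<otimes> b) \<otimes> c)"
        using a b c' r by (simp add: m_ac)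
      also have "\<dots> = \<zero>" using ab c r by (simp add: annihilator_def)
      finally show ?thesis .
    qed
    then have "C \<subseteq> ideal_coproduct R (annihilator R {a}) (annihilator R {b})"
      using a b
      by (auto simp: ideal_coproduct_def ideal_quotient_def Ann_a cgenideal_def C.Icarr
          annihilator_def[of R "{b}"])
    then have "C \<subseteq> annihilator R {a} \<or> C \<subseteq> annihilator R {b}"
      by (rule C.I_coprime[OF ids])
    then show "a \<in> annihilator R C \<or> b \<in> annihilator R C"
      using subset_annihilator_commute[OF C.a_subset] a b by simp
  qed
qed

lemma coprimeideal_annihilator:
  assumes "primeideal P R"
  shows "coprimeideal (annihilator R P) R"
proof -
  interpret P: primeideal P R by fact
  have AnnP: "annihilator R (annihilator R P) = P"
    by (rule annihilator_annihilator[OF P.ideal_axioms])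
  have idA: "ideal (annihilator R P) R" by (rule ideal_annihilator[OF P.a_subset])
  show ?thesis
  proof (intro coprimeideal.intro coprimeideal_axioms.intro idA cring_axioms)
    \<comment> \<open>If Ann(P) were 0, then P = Ann(0) would be the whole ring, but a prime ideal
      is proper.\<close>
    show "annihilator R P \<noteq> {\<zero>}"
      using AnnP annihilator_zero P.I_notcarr by metis
  next
    fix I J assume I: "ideal I R" and J: "ideal J R"
      and sub: "annihilator R P \<subseteq> ideal_coproduct R I J"
    \<comment> \<open>Ann reverses the inclusion of Ann(K) in P, and duality turns Ann(Ann(K)) back
      into K. It thus suffices to place Ann(I) or Ann(J) inside P.\<close>
    have sub_if: "annihilator R P \<subseteq> K" if K: "ideal K R" and "annihilator R K \<subseteq> P" for K
    proof -
      have "annihilator R P \<subseteq> annihilator R (annihilator R K)"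
        using that(2) by (auto simp: annihilator_def[of R P] annihilator_def[of R "annihilator R K"])
      then show ?thesis by (simp add: annihilator_annihilator[OF K])
    qed
    have mem: "x \<otimes> y \<in> P" if x: "x \<in> annihilator R I" and y: "y \<in> annihilator R J" for x y
    proof -
      have xy: "x \<in> carrier R" "y \<in> carrier R" using x y by (auto simp: annihilator_def)
      have "x \<otimes> y \<otimes> z = \<zero>" if z: "z \<in> annihilator R P" for z
      proof -
        have "z \<in> carrier R" using z by (simp add: annihilator_def)
        then have "x \<otimes> y \<otimes> z = y \<otimes> (z \<otimes> x)" using xy by (simp add: m_ac)
        \<comment> \<open>The hypothesis on the coproduct says that \<open>z\<close> multiplies
          Ann(I) into J, and \<open>y\<close> kills J.\<close>
        moreover have "z \<otimes> x \<in> J"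
          using sub z x by (auto simp: ideal_coproduct_def ideal_quotient_def)
        ultimately show ?thesis using y by (simp add: annihilator_def)
      qed
      then have "x \<otimes> y \<in> annihilator R (annihilator R P)"
        using xy by (simp add: annihilator_def[of R "annihilator R P"])
      then show ?thesis by (simp add: AnnP)
    qed
    have "annihilator R I \<subseteq> P \<or> annihilator R J \<subseteq> P"
    proof (rule ccontr)
      assume "\<not> ?thesis"
      then obtain x y where *: "x \<in> annihilator R I" "x \<notin> P" "y \<in> annihilator R J" "y \<notin> P"
        by blast
      then have "x \<in> carrier R" "y \<in> carrier R" by (auto simp: annihilator_def)
      then show False using P.I_prime mem * by blast
    qed
    then show "annihilator R P \<subseteq> I \<or> annihilator R P \<subseteq> J"
      using sub_if I J by blast
  qed
qed

text \<open>This is \<open>subset_annihilator_commute\<close> for Ann(I) and Ann(J), with the double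
  annihilators removed by duality.\<close>

lemma annihilator_subset_commute:
  assumes "ideal I R" "ideal J R"
  shows "annihilator R I \<subseteq> J \<longleftrightarrow> annihilator R J \<subseteq> I"
proof -
  have car: "annihilator R S \<subseteq> carrier R" for S by (auto simp: annihilator_def)
  show ?thesis
    using subset_annihilator_commute[OF car[of I] car[of J]]
    by (simp add: annihilator_annihilator assms)
qed

lemma ideal_if_CoSp: "C \<in> CoSp R \<Longrightarrow> ideal C R"
  by (simp add: CoSp_def coprimeideal_def)

lemma ideal_if_Spec: "P \<in> Spec R \<Longrightarrow> ideal P R"
  by (simp add: Spec_def primeideal_def)

lemma annihilator_in_Spec: "C \<in> CoSp R \<Longrightarrow> annihilator R C \<in> Spec R"
  by (simp add: CoSp_def Spec_def primeideal_annihilator)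

lemma annihilator_in_CoSp: "P \<in> Spec R \<Longrightarrow> annihilator R P \<in> CoSp R"
  by (simp add: CoSp_def Spec_def coprimeideal_annihilator)

text \<open>Preimages of Zariski-closed sets are closed: I lies in Ann(C) exactly when C lies in
  Ann(I).\<close>

lemma vimage_annihilator_zero_locus:
  assumes "ideal I R"
  shows "{C \<in> CoSp R. annihilator R C \<in> zero_locus R I} = Vc R (annihilator R I)"
proof -
  have "I \<subseteq> annihilator R C \<longleftrightarrow> C \<subseteq> annihilator R I" if "C \<in> CoSp R" for C
    using subset_annihilator_commute ideal_if_CoSp[OF that] assms
    by (meson ideal.Icarr subsetI)
  then show ?thesis
    by (auto simp: zero_locus_def Vc_def annihilator_in_Spec)
qed

text \<open>The counterpart for the inverse map: Ann(P) lies in I exactly when Ann(I) lies in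
  P.\<close>

lemma vimage_annihilator_Vc:
  assumes "ideal I R"
  shows "{P \<in> Spec R. annihilator R P \<in> Vc R I} = zero_locus R (annihilator R I)"
  using annihilator_subset_commute[OF ideal_if_Spec assms]
  by (auto simp: zero_locus_def Vc_def annihilator_in_CoSp)

lemma homeomorphic_maps_annihilator:
  "homeomorphic_maps (cosp_topology R) (zariski_topology R) (annihilator R) (annihilator R)"
proof -
  have id: "ideal (annihilator R I) R" if "ideal I R" for I
    using that by (auto intro: ideal_annihilator dest: ideal.Icarr)
  have "continuous_map (cosp_topology R) (zariski_topology R) (annihilator R)"
    unfolding continuous_map_closedin topspace_cosp_topology topspace_zariski_topology
      closedin_cosp_topology closedin_zariski_topology
    using id vimage_annihilator_zero_locus annihilator_in_Spec by blast
  moreover have "continuous_map (zariski_topology R) (cosp_topology R) (annihilator R)"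
    unfolding continuous_map_closedin topspace_cosp_topology topspace_zariski_topology
      closedin_cosp_topology closedin_zariski_topology
    using id vimage_annihilator_Vc annihilator_in_CoSp by blast
  \<comment> \<open>Coprime and prime ideals are ideals, so by duality both composites of Ann with
    itself are identities.\<close>
  ultimately show ?thesis
    by (simp add: homeomorphic_maps_def topspace_cosp_topology topspace_zariski_topology
        annihilator_annihilator ideal_if_CoSp ideal_if_Spec)
qed

end

theorem theorem3:
  fixes A :: "('a, 'b) ring_scheme"
  assumes "dual_ring A"
  shows "homeomorphic_map (cosp_topology A) (zariski_topology A) (annihilator A)"
  using dual_ring.homeomorphic_maps_annihilator[OF assms] homeomorphic_maps_map by blast

end
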